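(* Let $\{x^k\}$ be the sequence generated by the parameter-free generalized conditional gradient algorithm (FGM-CondG) described in the context, and let $\tilde k_0=\lceil(\log_2(L_{-1}/\tilde L_0))_+\rceil$. Then, for all $k\ge\tilde k_0$, $$\min_{0\le j\le k}|\theta(x^j)|\le\max\left\{\frac{4(f_0^{\max}-f^{\inf})}{k+1-\tilde k_0},\ \left(\frac{2^{2+\frac1\nu}M_\nu^{\frac1\nu}D^{\frac{1+\nu}{\nu}}(f_0^{\max}-f^{\inf})}{k+1-\tilde k_0}\right)^{\frac{\nu}{1+\nu}}\right\}.$$
   Context: Let $m,n\ge 1$. For each $i\in\{1,\dots,m\}$ let $g_i:\mathbb{R}^n\to\mathbb{R}\cup\{+\infty\}$ be proper, convex and lower semicontinuous, let $h_i:\mathbb{R}^n\to\mathbb{R}$ be continuously differentiable, and set $f_i=g_i+h_i$, $F=(f_1,\dots,f_m)^\top$, $G=(g_1,\dots,g_m)^\top$, $H=(h_1,\dots,h_m)^\top$. Put $\mathrm{dom}(g_i)=\{x: g_i(x)<+\infty\}$ and $\mathrm{dom}(G)=\bigcap_i\mathrm{dom}(g_i)$; $\mathrm{dom}(G)$ is assumed nonempty, convex and compact, with diameter $D=\sup_{x,y\in\mathrm{dom}(G)}\|x-y\|$ ($\|\cdot\|$ the Euclidean norm). Hölder assumption: there are $\nu\in(0,1]$ and $M_{i,\nu}>0$ with $\|\nabla h_i(x)-\nabla h_i(y)\|\le M_{i,\nu}\|x-y\|^\nu$ for all $x,y\in\mathrm{dom}(g_i)$, $i=1,\dots,m$; set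 $M_\nu=\max_i M_{i,\nu}$. For $u,v\in\mathbb{R}^m$, $u\preceq v$ means $u_i\le v_i$ for all $i$; $e=(1,\dots,1)^\top\in\mathbb{R}^m$; $\varrho_+=\max\{\varrho,0\}$. For $x\in\mathrm{dom}(G)$ the gap function is $\theta(x)=\min_{u\in\mathbb{R}^n}\max_{1\le i\le m}\{g_i(u)-g_i(x)+\langle\nabla h_i(x),u-x\rangle\}$ (so $\theta(x)\le0$), and $s(x)\in\mathrm{dom}(G)$ denotes a chosen minimizer. Algorithm FGM-CondG: start from $x^0\in\mathrm{dom}(G)$ and $L_{-1}>0$. At iteration $k=0,1,\dots$ compute $s(x^k)$ and $\theta(x^k)$; stop if $\theta(x^k)=0$. Otherwise, for $\ell=0,1,\dots$ set $$L_k^\ell=2^{\ell-1}L_{k-1},\quad t_k^\ell=\min\left\{1,\frac{|\theta(x^k)|}{2L_k^\ell\|s(x^k)-x^k\|^2}\right\},\quad x^{k+1}_\ell=x^k+t_k^\ell(s(x^k)-x^k),$$ until (at the first such $\ell$) $$F(x^{k+1}_\ell)\preceq F(x^k)+\left(-\tfrac12t_k^\ell|\theta(x^k)|+\tfrac12L_k^\ell(t_k^\ell)^2\|s(x^k)-x^k\|^2\right)e,$$ and for this $\ell$ put $x^{k+1}=x^{k+1}_\ell$, $L_k=L_k^\ell$, $t_k=t_k^\ell$. The generated sequence is understood to be infinite, i.e. $\theta(x^k)\neq0$ for all $k$ (then $s(x^k)\ne x^k$). For $\varepsilon>0$ let $L(\varepsilon)=\left(\frac{1-\nu}{1+\nu}\cdot\frac1{2\varepsilon}\right)^{\frac{1-\nu}{1+\nu}}M_\nu^{\frac{2}{1+\nu}}$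 (with $0^0=1$, so $L(\varepsilon)=M_1$ if $\nu=1$), and $$\tilde L_k=\max\left\{L\left(\frac{|\theta(x^k)|}{2}\right),\left[L\left(\frac{|\theta(x^k)|^2}{4\|s(x^k)-x^k\|^2}\right)\right]^{\frac{1+\nu}{2\nu}}\right\}.$$ Finally $f_0^{\max}=\max_{1\le i\le m}f_i(x^0)$ and $f^{\inf}=\min_{1\le i\le m}f_i^*$, where $f_i^*=\inf\{f_i(x):x\in\mathrm{dom}(G)\}$. *)

theory Defs
  imports "HOL-Analysis.Analysis"
begin

section \<open>Extended-real-valued functions\<close>

text \<open>Functions into the reals extended by plus infinity are \<open>ereal\<close>-valued functions that never
  take the value \<open>-\<infinity>\<close>; this is part of properness.\<close>

definition proper :: "('a \<Rightarrow> ereal) \<Rightarrow> bool" where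
  "proper f \<longleftrightarrow> (\<forall>x. f x \<noteq> -\<infinity>) \<and> (\<exists>x. f x \<noteq> \<infinity>)"

text \<open>Only used for proper functions, so that no sum \<open>\<infinity> + (-\<infinity>)\<close> occurs; note that
  \<open>0 * \<infinity> = 0\<close> in \<open>ereal\<close>.\<close>

definition convex_fun :: "('a::real_vector \<Rightarrow> ereal) \<Rightarrow> bool" where
  "convex_fun f \<longleftrightarrow>
     (\<forall>x y. \<forall>u\<ge>0. \<forall>v\<ge>0. u + v = 1 \<longrightarrow>
        f (u *\<^sub>R x + v *\<^sub>R y) \<le> ereal u * f x + ereal v * f y)"

definition lsc :: "('a::topological_space \<Rightarrow> ereal) \<Rightarrow> bool" where
  "lsc f \<longleftrightarrow> (\<forall>x. f x \<le> Liminf (at x) f)"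

definition edom :: "('a \<Rightarrow> ereal) \<Rightarrow> 'a set" where
  "edom f = {x. f x < \<infinity>}"

section \<open>The composite multiobjective problem\<close>

text \<open>The index set \<open>{1,\<dots>,m}\<close> is a finite type \<open>'m\<close>. Vector-valued maps such as \<open>G\<close> and \<open>F\<close> are
  \<open>'m\<close>-indexed families, and the componentwise order is the pointwise order on functions.
  \<open>dh i y\<close> stands for the gradient of \<open>h i\<close> at \<open>y\<close>.\<close>

definition domG :: "('m::finite \<Rightarrow> real ^ 'n \<Rightarrow> ereal) \<Rightarrow> (real ^ 'n) set" where
  "domG g = (\<Inter>i. edom (g i))"

definition objective ::
    "('m::finite \<Rightarrow> real ^ 'n \<Rightarrow> ereal) \<Rightarrow> ('m \<Rightarrow> real ^ 'n \<Rightarrow> real) \<Rightarrow> real ^ 'n \<Rightarrow> 'm \<Rightarrow> ereal" where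
  "objective g h y = (\<lambda>i. g i y + ereal (h i y))"

definition gap_model ::
    "('m::finite \<Rightarrow> real ^ 'n \<Rightarrow> ereal) \<Rightarrow> ('m \<Rightarrow> real ^ 'n \<Rightarrow> real ^ 'n)
      \<Rightarrow> real ^ 'n \<Rightarrow> real ^ 'n \<Rightarrow> ereal" where
  "gap_model g dh y u = (MAX i. g i u - g i y + ereal (dh i y \<bullet> (u - y)))"

text \<open>For \<open>y \<in> domG g\<close> the infimum is attained and finite under the standing assumptions, so that
  \<open>real_of_ereal\<close> is only a change of type. The same holds for \<open>f0_max\<close> (at a point of
  \<open>domG g\<close>) and for \<open>f_inf\<close>.\<close>

definition gap ::
    "('m::finite \<Rightarrow> real ^ 'n \<Rightarrow> ereal) \<Rightarrow> ('m \<Rightarrow> real ^ 'n \<Rightarrow> real ^ 'n) \<Rightarrow> real ^ 'n \<Rightarrow> real" where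
  "gap g dh y = real_of_ereal (INF u. gap_model g dh y u)"

definition f0_max ::
    "('m::finite \<Rightarrow> real ^ 'n \<Rightarrow> ereal) \<Rightarrow> ('m \<Rightarrow> real ^ 'n \<Rightarrow> real) \<Rightarrow> real ^ 'n \<Rightarrow> real" where
  "f0_max g h x0 = real_of_ereal (MAX i. objective g h x0 i)"

definition f_inf ::
    "('m::finite \<Rightarrow> real ^ 'n \<Rightarrow> ereal) \<Rightarrow> ('m \<Rightarrow> real ^ 'n \<Rightarrow> real) \<Rightarrow> real" where
  "f_inf g h = real_of_ereal (MIN i. INF y\<in>domG g. objective g h y i)"

section \<open>The parameter-free generalized conditional gradient algorithm\<close>

definition trial_step ::
    "('m::finite \<Rightarrow> real ^ 'n \<Rightarrow> ereal) \<Rightarrow> ('m \<Rightarrow> real ^ 'n \<Rightarrow> real ^ 'n)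
      \<Rightarrow> (real ^ 'n \<Rightarrow> real ^ 'n) \<Rightarrow> real ^ 'n \<Rightarrow> real \<Rightarrow> real" where
  "trial_step g dh s y L = min 1 (\<bar>gap g dh y\<bar> / (2 * L * (norm (s y - y))\<^sup>2))"

definition trial_point ::
    "('m::finite \<Rightarrow> real ^ 'n \<Rightarrow> ereal) \<Rightarrow> ('m \<Rightarrow> real ^ 'n \<Rightarrow> real ^ 'n)
      \<Rightarrow> (real ^ 'n \<Rightarrow> real ^ 'n) \<Rightarrow> real ^ 'n \<Rightarrow> real \<Rightarrow> real ^ 'n" where
  "trial_point g dh s y L = y + trial_step g dh s y L *\<^sub>R (s y - y)"

definition accepted ::
    "('m::finite \<Rightarrow> real ^ 'n \<Rightarrow> ereal) \<Rightarrow> ('m \<Rightarrow> real ^ 'n \<Rightarrow> real)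
      \<Rightarrow> ('m \<Rightarrow> real ^ 'n \<Rightarrow> real ^ 'n) \<Rightarrow> (real ^ 'n \<Rightarrow> real ^ 'n) \<Rightarrow> real ^ 'n \<Rightarrow> real \<Rightarrow> bool" where
  "accepted g h dh s y L \<longleftrightarrow>
     (let t = trial_step g dh s y L in
       objective g h (trial_point g dh s y L) \<le>
         (\<lambda>i. objective g h y i +
            ereal (- (1/2) * t * \<bar>gap g dh y\<bar> + (1/2) * L * t\<^sup>2 * (norm (s y - y))\<^sup>2)))"

text \<open>\<open>Linit\<close> is the initial constant, indexed by \<open>-1\<close> in the algorithm.\<close>

definition prev_L :: "real \<Rightarrow> (nat \<Rightarrow> real) \<Rightarrow> nat \<Rightarrow> real" where
  "prev_L Linit L k = (case k of 0 \<Rightarrow> Linit | Suc j \<Rightarrow> L j)"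

definition trial_L :: "real \<Rightarrow> (nat \<Rightarrow> real) \<Rightarrow> nat \<Rightarrow> nat \<Rightarrow> real" where
  "trial_L Linit L k l = 2 powi (int l - 1) * prev_L Linit L k"

text \<open>\<open>x\<close>, \<open>L\<close> and \<open>t\<close> are the infinite sequences produced by a run of the algorithm that never
  meets the stopping criterion; at each iteration \<open>l\<close> is the first accepted backtracking index.\<close>

definition FGM_CondG ::
    "('m::finite \<Rightarrow> real ^ 'n \<Rightarrow> ereal) \<Rightarrow> ('m \<Rightarrow> real ^ 'n \<Rightarrow> real)
      \<Rightarrow> ('m \<Rightarrow> real ^ 'n \<Rightarrow> real ^ 'n) \<Rightarrow> (real ^ 'n \<Rightarrow> real ^ 'n)
      \<Rightarrow> real \<Rightarrow> (nat \<Rightarrow> real ^ 'n) \<Rightarrow> (nat \<Rightarrow> real) \<Rightarrow> (nat \<Rightarrow> real) \<Rightarrow> bool" where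
  "FGM_CondG g h dh s Linit x L t \<longleftrightarrow>
     x 0 \<in> domG g \<and> Linit > 0 \<and>
     (\<forall>k. gap g dh (x k) \<noteq> 0 \<and>
        (\<exists>l. accepted g h dh s (x k) (trial_L Linit L k l) \<and>
             (\<forall>l'<l. \<not> accepted g h dh s (x k) (trial_L Linit L k l')) \<and>
             L k = trial_L Linit L k l \<and>
             t k = trial_step g dh s (x k) (L k) \<and>
             x (Suc k) = trial_point g dh s (x k) (L k)))"

section \<open>Constants of the complexity bound\<close>

text \<open>The case distinction implements the convention \<open>0\<^sup>0 = 1\<close>: in Isabelle \<open>0 powr 0 = 0\<close>.\<close>

definition L_eps :: "real \<Rightarrow> real \<Rightarrow> real \<Rightarrow> real" where
  "L_eps \<nu> M \<epsilon> =
     (if \<nu> = 1 then M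
      else ((1 - \<nu>) / (1 + \<nu>) * (1 / (2 * \<epsilon>))) powr ((1 - \<nu>) / (1 + \<nu>)) * M powr (2 / (1 + \<nu>)))"

definition L_tilde ::
    "('m::finite \<Rightarrow> real ^ 'n \<Rightarrow> ereal) \<Rightarrow> ('m \<Rightarrow> real ^ 'n \<Rightarrow> real ^ 'n)
      \<Rightarrow> (real ^ 'n \<Rightarrow> real ^ 'n) \<Rightarrow> real \<Rightarrow> real \<Rightarrow> real ^ 'n \<Rightarrow> real" where
  "L_tilde g dh s \<nu> M y =
     max (L_eps \<nu> M (\<bar>gap g dh y\<bar> / 2))
         (L_eps \<nu> M (\<bar>gap g dh y\<bar>\<^sup>2 / (4 * (norm (s y - y))\<^sup>2)) powr ((1 + \<nu>) / (2 * \<nu>)))"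

end

theory Submission
  imports Defs
begin

text \<open>Let \<open>\<theta>\<^sub>0\<close> be the smallest gap among the first \<open>k + 1\<close> iterates. The descent inequality for
  Hoelder continuous gradients shows that a rejected constant \<open>L'\<close> satisfies
  \<open>2 L' \<le> K = (M (2 D / \<theta>\<^sub>0) powr (1 - \<nu>)) powr (1 / \<nu>)\<close>. Going through \<open>L_tilde\<close> here would only
  give \<open>2 L' \<le> 2 * L_tilde\<close>, too weak for the constant of the theorem when \<open>\<nu>\<close> is close to \<open>1\<close>:
  the failed test has to be exploited with its full quadratic term.
  Hence \<open>L j\<close> either is at most \<open>K\<close>, or results from halving \<open>Linit\<close> in every iteration up to \<open>j\<close>.
  In the latter case and for \<open>j \<ge> k0\<close>, \<open>L j\<close> is at most half of the initial \<open>L_tilde\<close>, which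
  is at most \<open>K\<close> or \<open>\<theta>\<^sub>0 / D\<^sup>2\<close>. So every iteration from \<open>k0\<close> on lowers each objective by at least
  \<open>min (\<theta>\<^sub>0 / 4) (\<theta>\<^sub>0\<^sup>2 / (8 K D\<^sup>2))\<close>, and the total decrease is at most \<open>f0_max - f_inf\<close>.\<close>

section \<open>Convexity, Hoelder descent and lower semicontinuity\<close>

text \<open>Weighted arithmetic-geometric mean inequality for 2 and 1 with weights
  \<open>\<nu>\<close> and \<open>1 - \<nu>\<close>.\<close>

lemma two_powr_le_one_plus:
  fixes \<nu> :: real
  assumes "0 \<le> \<nu>" "\<nu> \<le> 1"
  shows "2 powr \<nu> \<le> 1 + \<nu>"
  using Youngs_inequality_0[of \<nu> "1 - \<nu>" 2 1] assms by simp

text \<open>Restricting \<open>f\<close> to the segment and subtracting the claimed upper bound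
  leaves \<open>\<psi>\<close>, whose derivative is nonpositive by Cauchy-Schwarz and the Hoelder
  condition. Both assumptions concern the segment only, since the Hoelder condition is available
  only on the domains of the \<open>g i\<close>.\<close>

lemma hoelder_descent:
  fixes f :: "'a::real_inner \<Rightarrow> real" and df :: "'a \<Rightarrow> 'a"
  assumes grad: "\<And>\<tau>. 0 \<le> \<tau> \<Longrightarrow> \<tau> \<le> 1 \<Longrightarrow> GDERIV f (y + \<tau> *\<^sub>R d) :> df (y + \<tau> *\<^sub>R d)"
    and hoelder: "\<And>\<tau>. 0 \<le> \<tau> \<Longrightarrow> \<tau> \<le> 1 \<Longrightarrow>
      norm (df (y + \<tau> *\<^sub>R d) - df y) \<le> M * norm (\<tau> *\<^sub>R d) powr \<nu>"
    and nu: "0 < \<nu>"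
  shows "f (y + d) \<le> f y + df y \<bullet> d + M / (1 + \<nu>) * norm d powr (1 + \<nu>)"
proof -
  define \<psi> where "\<psi> = (\<lambda>\<tau>. f (y + \<tau> *\<^sub>R d) - \<tau> * (df y \<bullet> d)
    - M / (1 + \<nu>) * norm d powr (1 + \<nu>) * \<tau> powr (1 + \<nu>))"
  have D: "((\<lambda>\<tau>. f (y + \<tau> *\<^sub>R d)) has_real_derivative df (y + \<tau> *\<^sub>R d) \<bullet> d) (at \<tau>)"
    if "0 \<le> \<tau>" "\<tau> \<le> 1" for \<tau>
  proof -
    have "(f has_derivative (\<lambda>v. v \<bullet> df (y + \<tau> *\<^sub>R d))) (at (y + \<tau> *\<^sub>R d))"
      using grad[OF that] by (simp add: gderiv_def)
    then have "((\<lambda>\<tau>. f (y + \<tau> *\<^sub>R d)) has_derivative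
        (\<lambda>z. (z *\<^sub>R d) \<bullet> df (y + \<tau> *\<^sub>R d))) (at \<tau>)"
      by (rule has_derivative_compose[rotated]) (auto intro!: derivative_eq_intros)
    then show ?thesis
      by (simp add: has_field_derivative_def inner_commute mult_commute_abs)
  qed
  have "\<psi> 1 \<le> \<psi> 0"
  \<comment> \<open>The open-interval rule is chosen so that \<open>\<tau> powr (1 + \<nu>)\<close>
    is differentiated only at positive \<open>\<tau>\<close>; continuity covers the
    endpoints.\<close>
  proof (rule DERIV_nonpos_imp_decreasing_open[where f = \<psi>])
    fix \<tau> :: real
    assume t: "0 < \<tau>" "\<tau> < 1"
    define v where "v = df (y + \<tau> *\<^sub>R d) \<bullet> d - df y \<bullet> d
        - M / (1 + \<nu>) * norm d powr (1 + \<nu>) * ((1 + \<nu>) * \<tau> powr \<nu>)"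
    have "(\<psi> has_real_derivative v) (at \<tau>)"
      unfolding \<psi>_def v_def using t by (auto intro!: derivative_eq_intros D)
    moreover have "v \<le> 0"
    proof -
      have "df (y + \<tau> *\<^sub>R d) \<bullet> d - df y \<bullet> d \<le> norm (df (y + \<tau> *\<^sub>R d) - df y) * norm d"
        by (metis inner_diff_left norm_cauchy_schwarz)
      also have "\<dots> \<le> M * norm (\<tau> *\<^sub>R d) powr \<nu> * norm d"
        using hoelder[of \<tau>] t by (intro mult_right_mono) auto
      also have "\<dots> = M * norm d powr (1 + \<nu>) * \<tau> powr \<nu>"
        using t by (simp add: powr_mult powr_add mult_ac)
      finally show ?thesis
        using nu by (simp add: v_def)
    qed
    ultimately show "\<exists>v. DERIV \<psi> \<tau> :> v \<and> v \<le> 0" by blast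
  next
    have "continuous_on {0..1} (\<lambda>\<tau>. f (y + \<tau> *\<^sub>R d))"
      by (rule continuous_at_imp_continuous_on) (auto intro!: DERIV_isCont D)
    then show "continuous_on {0..1} \<psi>"
      unfolding \<psi>_def using nu 
      by (intro continuous_on_diff continuous_on_mult continuous_on_powr' continuous_on_const continuous_on_id) auto
  qed simp
  then show ?thesis using nu by (simp add: \<psi>_def)
qed

text \<open>Lower semicontinuity gives each point a neighbourhood with a real lower bound; the least
  bound over a finite subcover works on all of \<open>S\<close>.\<close>

lemma lsc_compact_bounded_below:
  fixes f :: "'a::topological_space \<Rightarrow> ereal"
  assumes f: "proper f" "lsc f" and S: "compact S"
  shows "\<exists>c::real. \<forall>x\<in>S. ereal c \<le> f x"
proof -
  have "\<exists>c U. open U \<and> x \<in> U \<and> (\<forall>z\<in>U. ereal c \<le> f z)" for x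
  proof -
    have "f x \<noteq> -\<infinity>" using f by (simp add: proper_def)
    then obtain c where c: "ereal c < f x"
      using ereal_dense2[of "-\<infinity>" "f x"] by auto
    with f have "ereal c < Liminf (at x) f"
      by (auto simp: lsc_def intro: less_le_trans)
    then have "eventually (\<lambda>z. ereal c < f z) (at x)"
      by (rule less_LiminfD)
    then obtain U where "open U" "x \<in> U" "\<forall>z\<in>U. z \<noteq> x \<longrightarrow> ereal c < f z"
      by (auto simp: eventually_at_topological)
    \<comment> \<open>The filter \<open>at x\<close> ignores \<open>x\<close> itself, so the bound
      at this point comes from the choice of \<open>c\<close>.\<close>
    then show ?thesis using c by (metis less_imp_le)
  qed
  then obtain c U where U: "\<And>x. open (U x)" "\<And>x. x \<in> U x"
      and c: "\<And>x z. z \<in> U x \<Longrightarrow> ereal (c x) \<le> f z"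
    by metis
  obtain T where T: "finite T" "S \<subseteq> (\<Union>x\<in>T. U x)"
    using compactE_image[OF S, of S U] U by (metis UN_I subsetI)
  show ?thesis
  proof (cases "T = {}")
    case True then show ?thesis using T by auto
  next
    case False
    have "ereal (Min (c ` T)) \<le> f x" if x: "x \<in> S" for x
    proof -
      obtain z where "z \<in> T" "x \<in> U z" using T x by blast
      then show ?thesis using c[of x z] T by (meson Min_le finite_imageI imageI ereal_less_eq(3) order_trans)
    qed
    then show ?thesis by blast
  qed
qed

section \<open>Scalar estimates for the step size and the constants\<close>

text \<open>\<open>p\<close> is the quantity \<open>L t \<delta>\<^sup>2\<close>, which the step-size rule keeps below \<open>\<theta> / 2\<close>. Dividing the
  failed test by \<open>t\<close> reduces the claim to \<open>2 powr \<nu> \<le> 1 + \<nu>\<close>, in either branch of the rule.\<close>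

lemma rejected_L_bound:
  fixes \<theta> \<delta> L t M \<nu> :: real
  assumes pos: "0 < \<theta>" "0 < \<delta>" "0 < L" "0 < t" "0 < M"
    and nu: "0 < \<nu>" "\<nu> \<le> 1"
    and step: "L * t * \<delta>\<^sup>2 \<le> \<theta> / 2"
    and rejected: "t * \<theta> / 2 + L * t\<^sup>2 * \<delta>\<^sup>2 / 2 < M / (1 + \<nu>) * (t * \<delta>) powr (1 + \<nu>)"
  shows "2 * L \<le> (M * (2 * \<delta> / \<theta>) powr (1 - \<nu>)) powr (1 / \<nu>)"
proof -
  define p where "p = L * t * \<delta>\<^sup>2"
  have p: "0 < p" "2 * p \<le> \<theta>" using pos step by (auto simp: p_def)
  have "t * (\<theta> / 2 + p / 2) < t * (M / (1 + \<nu>) * (t powr \<nu> * \<delta> powr (1 + \<nu>)))"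
    using rejected pos by (simp add: p_def powr_mult powr_add algebra_simps power2_eq_square)
  then have "\<theta> / 2 + p / 2 < M / (1 + \<nu>) * (t powr \<nu> * \<delta> powr (1 + \<nu>))"
    using pos by (simp only: mult_less_cancel_left_pos)
  then have A: "(1 + \<nu>) * (\<theta> + p) < 2 * M * (t powr \<nu> * \<delta> powr (1 + \<nu>))"
    using nu by (simp add: field_simps)
  \<comment> \<open>One factor 2 of \<open>4 * p\<close> is absorbed by
    \<open>2 * p \<le> \<theta>\<close>; the other yields \<open>2 powr \<nu>\<close>, to be
    compared with the factor \<open>1 + \<nu>\<close> in \<open>A\<close>.\<close>
  have "(4 * p) powr \<nu> * \<theta> powr (1 - \<nu>) = 2 powr \<nu> * ((2 * p) powr \<nu> * \<theta> powr (1 - \<nu>))"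
    using powr_mult[of 2 "2 * p" \<nu>] by simp
  also have "\<dots> \<le> 2 powr \<nu> * (\<theta> powr \<nu> * \<theta> powr (1 - \<nu>))"
    using p pos nu by (intro mult_left_mono mult_right_mono powr_mono2) auto
  also have "\<dots> = 2 powr \<nu> * \<theta>"
    using pos by (simp flip: powr_add)
  also have "\<dots> \<le> (1 + \<nu>) * \<theta>"
    using two_powr_le_one_plus[of \<nu>] nu pos by (intro mult_right_mono) auto
  also have "\<dots> \<le> (1 + \<nu>) * (\<theta> + p)"
    using nu p by (intro mult_left_mono) auto
  also note A
  finally have "(4 * p) powr \<nu> * \<theta> powr (1 - \<nu>) < 2 * M * (t powr \<nu> * \<delta> powr (1 + \<nu>))" .
  moreover have "(4 * p) powr \<nu> = 2 powr \<nu> * (2 * L) powr \<nu> * (t powr \<nu> * \<delta> powr (2 * \<nu>))"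
  proof -
    have "4 * p = (2 * (2 * L)) * (t * (\<delta> * \<delta>))" by (simp add: p_def power2_eq_square)
    also have "\<dots> powr \<nu> = 2 powr \<nu> * (2 * L) powr \<nu> * (t powr \<nu> * (\<delta> powr \<nu> * \<delta> powr \<nu>))"
      by (simp only: powr_mult)
    finally show ?thesis by (simp flip: powr_add)
  qed
  moreover have "\<delta> powr (1 + \<nu>) = \<delta> powr (2 * \<nu>) * \<delta> powr (1 - \<nu>)"
    by (simp add: add.commute flip: powr_add)
  \<comment> \<open>The powers of \<open>t\<close> on both sides agree, so the step size
    cancels.\<close>
  ultimately have "(t powr \<nu> * \<delta> powr (2 * \<nu>)) * (2 powr \<nu> * (2 * L) powr \<nu> * \<theta> powr (1 - \<nu>))
      < (t powr \<nu> * \<delta> powr (2 * \<nu>)) * (2 * M * \<delta> powr (1 - \<nu>))"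
    by (simp add: mult_ac)
  then have "2 powr \<nu> * (2 * L) powr \<nu> * \<theta> powr (1 - \<nu>) < 2 * M * \<delta> powr (1 - \<nu>)"
    using pos by simp
  \<comment> \<open>Splitting 2 lets \<open>2 powr \<nu>\<close> cancel, while the rest joins
    \<open>\<delta>\<close> to form \<open>2 * \<delta> / \<theta>\<close>.\<close>
  also have "\<dots> = 2 powr \<nu> * (2 powr (1 - \<nu>) * M * \<delta> powr (1 - \<nu>))"
    by (simp flip: powr_add mult.assoc)
  finally have "(2 * L) powr \<nu> * \<theta> powr (1 - \<nu>) < 2 powr (1 - \<nu>) * M * \<delta> powr (1 - \<nu>)"
    by (simp add: mult.assoc)
  then have "(2 * L) powr \<nu> \<le> M * (2 * \<delta> / \<theta>) powr (1 - \<nu>)"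
    using pos by (simp add: powr_divide powr_mult field_simps)
  then have "((2 * L) powr \<nu>) powr (1 / \<nu>) \<le> (M * (2 * \<delta> / \<theta>) powr (1 - \<nu>)) powr (1 / \<nu>)"
    using nu by (intro powr_mono2) auto
  then show ?thesis using pos nu by (simp add: powr_powr)
qed

text \<open>The rule for \<open>t\<close> maximizes the concave quadratic on the right over the
  interval from 0 to 1. The interior maximum is the second entry of the minimum; if \<open>t\<close>
  is cut off at 1, then \<open>2 * L * \<delta>\<^sup>2 \<le> \<theta>\<close> leaves at least
  \<open>\<theta> / 4\<close>.\<close>

lemma step_decrease:
  fixes \<theta> \<delta> L t :: real
  assumes pos: "0 < \<theta>" "0 < \<delta>" "0 < L"
    and t: "t = min 1 (\<theta> / (2 * L * \<delta>\<^sup>2))"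
  shows "min (\<theta> / 4) (\<theta>\<^sup>2 / (8 * L * \<delta>\<^sup>2)) \<le> t * \<theta> / 2 - L * t\<^sup>2 * \<delta>\<^sup>2 / 2"
proof (cases "2 * L * \<delta>\<^sup>2 \<le> \<theta>")
  case True
  then have "t = 1" using pos t by simp
  then show ?thesis using True by (simp add: min_def)
next
  case False
  then have "t = \<theta> / (2 * L * \<delta>\<^sup>2)" using pos t by (simp add: min_def field_simps)
  then have "t * \<theta> / 2 - L * t\<^sup>2 * \<delta>\<^sup>2 / 2 = \<theta>\<^sup>2 / (8 * L * \<delta>\<^sup>2)"
    using pos by (simp add: power_divide power_mult_distrib) (simp add: field_simps power2_eq_square power4_eq_xxxx)
  then show ?thesis by simp
qed

lemma L_eps_pos:
  assumes "0 < M" "0 < \<nu>" "\<nu> \<le> 1" "0 < \<epsilon>"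
  shows "0 < L_eps \<nu> M \<epsilon>"
  using assms by (auto simp: L_eps_def)

text \<open>Raising to the power \<open>1 + \<nu>\<close> clears the denominators of the exponents,
  and the factor \<open>(1 - \<nu>) / (1 + \<nu>)\<close> is at most 1. For \<open>\<nu> = 1\<close>
  both sides equal \<open>M\<^sup>2\<close>.\<close>

lemma L_eps_le:
  assumes "0 < M" "0 < \<nu>" "\<nu> \<le> 1" "0 < \<epsilon>"
  shows "L_eps \<nu> M \<epsilon> powr (1 + \<nu>) \<le> (1 / (2 * \<epsilon>)) powr (1 - \<nu>) * M\<^sup>2"
proof (cases "\<nu> = 1")
  case True
  then show ?thesis using assms by (simp add: L_eps_def)
next
  case False
  have "L_eps \<nu> M \<epsilon> powr (1 + \<nu>)
      = ((1 - \<nu>) / (1 + \<nu>) * (1 / (2 * \<epsilon>))) powr (1 - \<nu>) * M\<^sup>2"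
  proof -
    have "2 / (1 + \<nu>) * (1 + \<nu>) = 2" "(1 - \<nu>) / (1 + \<nu>) * (1 + \<nu>) = 1 - \<nu>"
      using assms by (auto simp: field_simps)
    then show ?thesis
      using assms False by (simp add: L_eps_def powr_mult powr_powr del: times_divide_eq_left)
  qed
  also have "\<dots> \<le> (1 * (1 / (2 * \<epsilon>))) powr (1 - \<nu>) * M\<^sup>2"
    using assms by (intro mult_right_mono powr_mono2) (auto simp: field_simps)
  finally show ?thesis by simp
qed

lemma powr_le_imp_le_powr_inverse:
  fixes a b c :: real
  assumes "a powr c \<le> b" "0 \<le> a" "0 < c"
  shows "a \<le> b powr (1 / c)"
proof -
  have "a = (a powr c) powr (1 / c)" using assms by (simp add: powr_powr)
  also have "\<dots> \<le> b powr (1 / c)" using assms by (intro powr_mono2) auto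
  finally show ?thesis .
qed

text \<open>Here \<open>\<theta>\<^sub>0\<close> is the gap at the starting point and
  \<open>\<theta>\<close> a lower bound for it. The second entry on the left is always at most the
  first entry on the right; the first entry is so once it exceeds
  \<open>\<theta> / D\<^sup>2\<close>.\<close>

lemma L_tilde_bound:
  fixes \<theta> \<theta>\<^sub>0 \<delta> D M \<nu> :: real
  assumes pos: "0 < \<theta>" "\<theta> \<le> \<theta>\<^sub>0" "0 < \<delta>" "\<delta> \<le> D" "0 < M"
    and nu: "0 < \<nu>" "\<nu> \<le> 1"
  shows "max (L_eps \<nu> M (\<theta>\<^sub>0 / 2)) (L_eps \<nu> M (\<theta>\<^sub>0\<^sup>2 / (4 * \<delta>\<^sup>2)) powr ((1 + \<nu>) / (2 * \<nu>)))
    \<le> max ((M * (2 * D / \<theta>) powr (1 - \<nu>)) powr (1 / \<nu>)) (\<theta> / D\<^sup>2)"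
    (is "max ?A (?B powr _) \<le> max ?K _")
proof -
  have base: "(M * (c / \<theta>) powr (1 - \<nu>)) powr (1 / \<nu>) \<le> ?K" if "0 \<le> c" "c \<le> 2 * D" for c
    using that pos nu by (intro powr_mono2 mult_left_mono divide_right_mono) auto
  have A: "?A \<le> ?K" if less: "\<theta> / D\<^sup>2 < ?A"
  proof -
    have A0: "0 < ?A" using pos nu by (intro L_eps_pos) auto
    \<comment> \<open>Trading \<open>2 * \<nu>\<close> for \<open>(1 + \<nu>) - (1 - \<nu>)\<close>
      brings in both the explicit formula for \<open>?A\<close> and the case assumption, as a bound
      on \<open>1 / ?A\<close>.\<close>
    have "?A powr \<nu> * ?A powr \<nu> = ?A powr (1 + \<nu>) * (1 / ?A) powr (1 - \<nu>)"
      using A0 by (simp add: powr_divide flip: powr_add powr_diff)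
    also have "\<dots> \<le> ((1 / \<theta>\<^sub>0) powr (1 - \<nu>) * M\<^sup>2) * (D\<^sup>2 / \<theta>) powr (1 - \<nu>)"
    proof (intro mult_mono powr_mono2)
      show "?A powr (1 + \<nu>) \<le> (1 / \<theta>\<^sub>0) powr (1 - \<nu>) * M\<^sup>2"
        using L_eps_le[of M \<nu> "\<theta>\<^sub>0 / 2"] pos nu by simp
      show "1 / ?A \<le> D\<^sup>2 / \<theta>"
        using less A0 pos by (simp add: field_simps)
    qed (use A0 nu in auto)
    also have "\<dots> \<le> ((1 / \<theta>) powr (1 - \<nu>) * M\<^sup>2) * (D\<^sup>2 / \<theta>) powr (1 - \<nu>)"
      using pos nu by (intro mult_right_mono powr_mono2) (auto simp: field_simps)
    also have "\<dots> = M\<^sup>2 * ((1 / \<theta>) * (D\<^sup>2 / \<theta>)) powr (1 - \<nu>)"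
      by (simp only: powr_mult mult_ac)
    also have "(1 / \<theta>) * (D\<^sup>2 / \<theta>) = (D / \<theta>) * (D / \<theta>)"
      by (simp add: power2_eq_square)
    also have "M\<^sup>2 * ((D / \<theta>) * (D / \<theta>)) powr (1 - \<nu>) = (M * (D / \<theta>) powr (1 - \<nu>))\<^sup>2"
      by (simp only: powr_mult power_mult_distrib power2_eq_square mult_ac)
    finally have "?A powr \<nu> \<le> M * (D / \<theta>) powr (1 - \<nu>)"
      using pos by (intro power2_le_imp_le[of "?A powr \<nu>"]) (auto simp: power2_eq_square)
    then have "?A \<le> (M * (D / \<theta>) powr (1 - \<nu>)) powr (1 / \<nu>)"
      using A0 nu by (intro powr_le_imp_le_powr_inverse) auto
    also have "\<dots> \<le> ?K" using pos by (intro base) auto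
    finally show ?thesis .
  qed
  have B: "?B powr ((1 + \<nu>) / (2 * \<nu>)) \<le> ?K"
  proof -
    \<comment> \<open>The base is relaxed to the square of \<open>2 * D / \<theta>\<close>, so that
      the exponent \<open>1 / (2 * \<nu>)\<close> applied at the end gives exactly
      \<open>?K\<close>.\<close>
    have "?B powr (1 + \<nu>) \<le> (1 / (2 * (\<theta>\<^sub>0\<^sup>2 / (4 * \<delta>\<^sup>2)))) powr (1 - \<nu>) * M\<^sup>2"
      using pos nu by (intro L_eps_le) auto
    also have "\<dots> \<le> (4 * D\<^sup>2 / \<theta>\<^sup>2) powr (1 - \<nu>) * M\<^sup>2"
    proof (intro mult_right_mono powr_mono2)
      have "1 / (2 * (\<theta>\<^sub>0\<^sup>2 / (4 * \<delta>\<^sup>2))) = 2 * \<delta>\<^sup>2 / \<theta>\<^sub>0\<^sup>2" by simp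
      also have "\<dots> \<le> 4 * D\<^sup>2 / \<theta>\<^sup>2"
      proof (rule frac_le)
        have "\<delta>\<^sup>2 \<le> D\<^sup>2" "0 \<le> D\<^sup>2" using pos by (auto intro: power_mono)
        then show "2 * \<delta>\<^sup>2 \<le> 4 * D\<^sup>2" by linarith
        show "\<theta>\<^sup>2 \<le> \<theta>\<^sub>0\<^sup>2" using pos by (auto intro: power_mono)
      qed (use pos in auto)
      finally show "1 / (2 * (\<theta>\<^sub>0\<^sup>2 / (4 * \<delta>\<^sup>2))) \<le> 4 * D\<^sup>2 / \<theta>\<^sup>2" .
    qed (use nu in auto)
    also have "4 * D\<^sup>2 / \<theta>\<^sup>2 = (2 * D / \<theta>) * (2 * D / \<theta>)"
      by (simp add: power2_eq_square)
    also have "\<dots> powr (1 - \<nu>) * M\<^sup>2 = (M * (2 * D / \<theta>) powr (1 - \<nu>))\<^sup>2"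
      by (simp only: powr_mult power_mult_distrib power2_eq_square mult_ac)
    also have "\<dots> = (M * (2 * D / \<theta>) powr (1 - \<nu>)) powr 2"
      using pos by simp
    finally have "(?B powr (1 + \<nu>)) powr (1 / (2 * \<nu>))
        \<le> ((M * (2 * D / \<theta>) powr (1 - \<nu>)) powr 2) powr (1 / (2 * \<nu>))"
      using nu by (intro powr_mono2) auto
    then show ?thesis by (simp add: powr_powr)
  qed
  have "?A \<le> max ?K (\<theta> / D\<^sup>2)"
    using A by (cases "\<theta> / D\<^sup>2 < ?A") (auto simp: le_max_iff_disj)
  with B show ?thesis by auto
qed


text \<open>Solves the decrease estimate for \<open>\<theta>\<close>. With
  \<open>a = 1 / \<nu> - 1\<close> the inner constant contributes another
  \<open>\<theta> powr a\<close>, so the total power is \<open>2 + a = (1 + \<nu>) / \<nu>\<close>,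
  and \<open>8 * 2 powr a\<close> is \<open>2 powr (2 + 1 / \<nu>)\<close>.\<close>

lemma rate_from_decrease:
  fixes \<theta> D M \<nu> r :: real
  assumes pos: "0 < \<theta>" "0 < D" "0 < M" and nu: "0 < \<nu>" "\<nu> \<le> 1"
    and le: "\<theta>\<^sup>2 / (8 * (M * (2 * D / \<theta>) powr (1 - \<nu>)) powr (1 / \<nu>) * D\<^sup>2) \<le> r"
  shows "\<theta> \<le> (2 powr (2 + 1 / \<nu>) * M powr (1 / \<nu>) * D powr ((1 + \<nu>) / \<nu>) * r) powr (\<nu> / (1 + \<nu>))"
proof -
  define a where "a = 1 / \<nu> - 1"
  have a: "(1 - \<nu>) * (1 / \<nu>) = a" "1 / \<nu> = 1 + a" "(1 + \<nu>) / \<nu> = 2 + a"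
    using nu by (auto simp: a_def field_simps)
  have K: "(M * (2 * D / \<theta>) powr (1 - \<nu>)) powr (1 / \<nu>) = M powr (1 / \<nu>) * (2 powr a * D powr a / \<theta> powr a)"
    using a(1) by (simp only: powr_mult powr_powr powr_divide)
  have "\<theta>\<^sup>2 \<le> 8 * (M powr (1 / \<nu>) * (2 powr a * D powr a / \<theta> powr a)) * D\<^sup>2 * r"
    using le pos unfolding K by (simp add: field_simps)
  then have "\<theta>\<^sup>2 * \<theta> powr a \<le> (8 * 2 powr a) * M powr (1 / \<nu>) * (D\<^sup>2 * D powr a) * r"
    using pos by (simp add: field_simps)
  moreover have "z\<^sup>2 * z powr a = z powr (2 + a)" if "0 < z" for z :: real
    using that by (simp add: powr_add)
  moreover have "8 * 2 powr a = 2 powr (2 + (1 + a))"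
    by (simp add: powr_add)
  ultimately have "\<theta> powr (2 + a) \<le> 2 powr (2 + 1 / \<nu>) * M powr (1 / \<nu>) * D powr (2 + a) * r"
    using pos a by simp
  then have "\<theta> \<le> (2 powr (2 + 1 / \<nu>) * M powr (1 / \<nu>) * D powr (2 + a) * r) powr (1 / (2 + a))"
    using pos nu by (intro powr_le_imp_le_powr_inverse) (auto simp: a_def field_simps)
  then show ?thesis by (simp flip: a(3))
qed

section \<open>The composite problem: gap function, acceptance test and bounds on the
  objectives\<close>

locale composite_problem =
  fixes g :: "'m::finite \<Rightarrow> real ^ 'n \<Rightarrow> ereal"
    and h :: "'m \<Rightarrow> real ^ 'n \<Rightarrow> real"
    and dh :: "'m \<Rightarrow> real ^ 'n \<Rightarrow> real ^ 'n"
    and s :: "real ^ 'n \<Rightarrow> real ^ 'n"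
    and Mi :: "'m \<Rightarrow> real"
    and \<nu> M D :: real
  assumes g_proper: "\<And>i. proper (g i)"
    and g_convex: "\<And>i. convex_fun (g i)"
    and g_lsc: "\<And>i. lsc (g i)"
    and h_grad: "\<And>i y. GDERIV (h i) y :> dh i y"
    and domG_convex: "convex (domG g)"
    and domG_compact: "compact (domG g)"
    and nu: "0 < \<nu>" "\<nu> \<le> 1"
    and Mi_pos: "\<And>i. Mi i > 0"
    and hoelder: "\<And>i y z. y \<in> edom (g i) \<Longrightarrow> z \<in> edom (g i) \<Longrightarrow>
                    norm (dh i y - dh i z) \<le> Mi i * norm (y - z) powr \<nu>"
    and M_def: "M = (MAX i. Mi i)"
    and D_def: "D = diameter (domG g)"
    and s_minimizer: "\<And>y. y \<in> domG g \<Longrightarrow>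
                        s y \<in> domG g \<and> is_arg_min (gap_model g dh y) (\<lambda>u. True) (s y)"
begin

text \<open>Real-valued stand-in for \<open>g\<close>, faithful on \<open>domG g\<close>; all
  iterates stay there, so the estimates avoid extended arithmetic.\<close>

definition G :: "'m \<Rightarrow> real ^ 'n \<Rightarrow> real" where
  "G i y = real_of_ereal (g i y)"

abbreviation f :: "'m \<Rightarrow> real ^ 'n \<Rightarrow> real" where
  "f i y \<equiv> G i y + h i y"

lemma g_eq_G: "g i y = ereal (G i y)" if "y \<in> domG g"
proof -
  have "g i y \<noteq> \<infinity>" using that by (auto simp: domG_def edom_def)
  moreover have "g i y \<noteq> -\<infinity>" using g_proper by (auto simp: proper_def)
  ultimately show ?thesis unfolding G_def by (cases "g i y") auto
qed

lemma objective_eq: "objective g h y i = ereal (f i y)" if "y \<in> domG g"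
  using that by (simp add: objective_def g_eq_G)

lemma Mi_le: "Mi i \<le> M"
  unfolding M_def by (rule Max_ge) auto

lemma M_pos: "0 < M"
  using Mi_le Mi_pos less_le_trans by blast

lemma s_in: "y \<in> domG g \<Longrightarrow> s y \<in> domG g"
  using s_minimizer by blast

lemma gap_model_eq:
  assumes "y \<in> domG g" "u \<in> domG g"
  shows "gap_model g dh y u = ereal (MAX i. G i u - G i y + dh i y \<bullet> (u - y))"
proof -
  have "gap_model g dh y u = Max (ereal ` range (\<lambda>i. G i u - G i y + dh i y \<bullet> (u - y)))"
    using assms by (simp add: gap_model_def g_eq_G image_image)
  also have "\<dots> = ereal (MAX i. G i u - G i y + dh i y \<bullet> (u - y))"
    by (rule mono_Max_commute[symmetric]) (auto simp: mono_def)
  finally show ?thesis .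
qed

lemma gap_eq:
  assumes y: "y \<in> domG g"
  shows "gap g dh y = (MAX i. G i (s y) - G i y + dh i y \<bullet> (s y - y))"
proof -
  have "(INF u. gap_model g dh y u) = gap_model g dh y (s y)"
    using s_minimizer[OF y] by (intro antisym INF_lower INF_greatest)
      (auto simp: is_arg_min_linorder)
  then show ?thesis
    using y s_in by (simp add: gap_def gap_model_eq)
qed

lemma gap_component:
  assumes "y \<in> domG g"
  shows "G i (s y) - G i y + dh i y \<bullet> (s y - y) \<le> gap g dh y"
  unfolding gap_eq[OF assms] by (rule Max_ge) auto

text \<open>The point \<open>y\<close> itself competes in the minimization, and the model vanishes
  there.\<close>

lemma gap_nonpos:
  assumes y: "y \<in> domG g"
  shows "gap g dh y \<le> 0"
proof -
  have "gap_model g dh y (s y) \<le> gap_model g dh y y"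
    using s_minimizer[OF y] by (auto simp: is_arg_min_linorder)
  then show ?thesis
    using y s_in[OF y] by (simp add: gap_model_eq gap_eq)
qed

lemma s_neq:
  assumes "y \<in> domG g" "gap g dh y \<noteq> 0"
  shows "s y \<noteq> y"
proof
  assume "s y = y"
  then show False using gap_eq[OF assms(1)] assms(2) by simp
qed

lemma norm_step_le: "norm (s y - y) \<le> D" if "y \<in> domG g"
  using diameter_bounded_bound[OF compact_imp_bounded[OF domG_compact] s_in[OF that] that]
  by (simp add: D_def dist_norm)

lemma segment_in_domG:
  assumes "y \<in> domG g" "z \<in> domG g" "0 \<le> t" "t \<le> 1"
  shows "y + t *\<^sub>R (z - y) \<in> domG g"
proof -
  have "y + t *\<^sub>R (z - y) = (1 - t) *\<^sub>R y + t *\<^sub>R z" by (simp add: algebra_simps)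
  then show ?thesis using convexD[OF domG_convex, of y z "1 - t" t] assms by simp
qed

lemma G_convex:
  assumes "y \<in> domG g" "z \<in> domG g" "0 \<le> t" "t \<le> 1"
  shows "G i (y + t *\<^sub>R (z - y)) \<le> G i y + t * (G i z - G i y)"
proof -
  have eq: "y + t *\<^sub>R (z - y) = (1 - t) *\<^sub>R y + t *\<^sub>R z" by (simp add: algebra_simps)
  have "g i ((1 - t) *\<^sub>R y + t *\<^sub>R z) \<le> ereal (1 - t) * g i y + ereal t * g i z"
    using g_convex[of i] assms unfolding convex_fun_def by simp
  then have "ereal (G i (y + t *\<^sub>R (z - y))) \<le> ereal ((1 - t) * G i y + t * G i z)"
    using assms segment_in_domG[OF assms] by (simp add: g_eq_G flip: eq)
  then show ?thesis by (simp add: algebra_simps)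
qed

lemma h_descent:
  assumes "y \<in> domG g" "z \<in> domG g" "0 \<le> t" "t \<le> 1"
  shows "h i (y + t *\<^sub>R (z - y)) \<le> h i y + t * (dh i y \<bullet> (z - y))
    + M / (1 + \<nu>) * (t * norm (z - y)) powr (1 + \<nu>)"
proof -
  have "h i (y + t *\<^sub>R (z - y)) \<le> h i y + dh i y \<bullet> (t *\<^sub>R (z - y))
    + M / (1 + \<nu>) * norm (t *\<^sub>R (z - y)) powr (1 + \<nu>)"
  proof (rule hoelder_descent)
    fix \<tau> :: real
    assume \<tau>: "0 \<le> \<tau>" "\<tau> \<le> 1"
    \<comment> \<open>Parameter \<open>\<tau>\<close> on the shortened segment is parameter
      \<open>\<tau> * t\<close> on the segment from \<open>y\<close> to \<open>z\<close>, which
      convexity keeps inside \<open>domG g\<close>.\<close>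
    let ?p = "y + \<tau> *\<^sub>R t *\<^sub>R (z - y)"
    have "?p \<in> domG g"
      using segment_in_domG[OF assms(1,2), of "\<tau> * t"] \<tau> assms by (simp add: mult_le_one)
    then have "norm (dh i ?p - dh i y) \<le> Mi i * norm (?p - y) powr \<nu>"
      using assms by (intro hoelder) (auto simp: domG_def)
    also have "\<dots> \<le> M * norm (?p - y) powr \<nu>"
      using Mi_le by (intro mult_right_mono) auto
    finally show "norm (dh i ?p - dh i y) \<le> M * norm (\<tau> *\<^sub>R t *\<^sub>R (z - y)) powr \<nu>"
      by simp
  qed (use h_grad nu in auto)
  then show ?thesis using assms by simp
qed

lemma trial_step_bounds:
  assumes "0 < L" "y \<in> domG g" "gap g dh y \<noteq> 0"
  shows "0 < trial_step g dh s y L" "trial_step g dh s y L \<le> 1"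
    "L * trial_step g dh s y L * (norm (s y - y))\<^sup>2 \<le> \<bar>gap g dh y\<bar> / 2"
proof -
  have pos: "0 < L * (norm (s y - y))\<^sup>2" using assms s_neq by simp
  then show "0 < trial_step g dh s y L" "trial_step g dh s y L \<le> 1"
    using assms by (auto simp: trial_step_def)
  have "trial_step g dh s y L \<le> \<bar>gap g dh y\<bar> / (2 * L * (norm (s y - y))\<^sup>2)"
    by (simp add: trial_step_def)
  then have "trial_step g dh s y L * (2 * (L * (norm (s y - y))\<^sup>2)) \<le> \<bar>gap g dh y\<bar>"
    using pos by (subst (asm) pos_le_divide_eq) (auto simp: mult_ac)
  then show "L * trial_step g dh s y L * (norm (s y - y))\<^sup>2 \<le> \<bar>gap g dh y\<bar> / 2"
    by (simp add: mult_ac)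
qed

lemma trial_point_in:
  assumes "0 < L" "y \<in> domG g" "gap g dh y \<noteq> 0"
  shows "trial_point g dh s y L \<in> domG g"
  unfolding trial_point_def using trial_step_bounds[OF assms] assms s_in
  by (intro segment_in_domG) auto

lemma accepted_iff:
  assumes "0 < L" "y \<in> domG g" "gap g dh y \<noteq> 0"
  shows "accepted g h dh s y L \<longleftrightarrow>
    (\<forall>i. f i (trial_point g dh s y L) \<le> f i y - (trial_step g dh s y L * \<bar>gap g dh y\<bar> / 2
      - L * (trial_step g dh s y L)\<^sup>2 * (norm (s y - y))\<^sup>2 / 2))"
  using assms trial_point_in[OF assms]
  by (simp add: accepted_def Let_def le_fun_def objective_eq algebra_simps)

lemma accepted_decrease:
  assumes "0 < L" "y \<in> domG g" "gap g dh y \<noteq> 0" "accepted g h dh s y L"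
  shows "f i (trial_point g dh s y L)
    \<le> f i y - min (\<bar>gap g dh y\<bar> / 4) (\<bar>gap g dh y\<bar>\<^sup>2 / (8 * L * (norm (s y - y))\<^sup>2))"
proof -
  have "min (\<bar>gap g dh y\<bar> / 4) (\<bar>gap g dh y\<bar>\<^sup>2 / (8 * L * (norm (s y - y))\<^sup>2))
    \<le> trial_step g dh s y L * \<bar>gap g dh y\<bar> / 2
      - L * (trial_step g dh s y L)\<^sup>2 * (norm (s y - y))\<^sup>2 / 2"
    using assms s_neq by (intro step_decrease) (auto simp: trial_step_def)
  moreover have "f i (trial_point g dh s y L) \<le> f i y - (trial_step g dh s y L * \<bar>gap g dh y\<bar> / 2
      - L * (trial_step g dh s y L)\<^sup>2 * (norm (s y - y))\<^sup>2 / 2)"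
    using accepted_iff[OF assms(1-3)] assms(4) by blast
  ultimately show ?thesis by linarith
qed

text \<open>Some component \<open>i\<close> violates the test. Convexity of \<open>G i\<close> and
  Hoelder descent for \<open>h i\<close> bound the same value from above, with the gap as slope;
  comparing the two gives the hypothesis of \<open>rejected_L_bound\<close>.\<close>

lemma rejected_bound:
  assumes L: "0 < L" and y: "y \<in> domG g" and gap: "gap g dh y \<noteq> 0"
    and rejected: "\<not> accepted g h dh s y L"
  shows "2 * L \<le> (M * (2 * norm (s y - y) / \<bar>gap g dh y\<bar>) powr (1 - \<nu>)) powr (1 / \<nu>)"
proof -
  let ?t = "trial_step g dh s y L" and ?\<theta> = "\<bar>gap g dh y\<bar>" and ?\<delta> = "norm (s y - y)"
  note t = trial_step_bounds[OF L y gap]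
  obtain i where i: "f i y - (?t * ?\<theta> / 2 - L * ?t\<^sup>2 * ?\<delta>\<^sup>2 / 2) < f i (y + ?t *\<^sub>R (s y - y))"
    using rejected unfolding accepted_iff[OF L y gap] trial_point_def by (auto simp: not_le)
  have "f i (y + ?t *\<^sub>R (s y - y)) \<le> f i y + ?t * (G i (s y) - G i y + dh i y \<bullet> (s y - y))
      + M / (1 + \<nu>) * (?t * ?\<delta>) powr (1 + \<nu>)"
    using G_convex[OF y s_in[OF y], of ?t i] h_descent[OF y s_in[OF y], of ?t i] t
    by (simp add: algebra_simps)
  also have "?t * (G i (s y) - G i y + dh i y \<bullet> (s y - y)) \<le> ?t * (- ?\<theta>)"
    using gap_component[OF y, of i] gap_nonpos[OF y] t by (intro mult_left_mono) auto
  finally have "?t * ?\<theta> / 2 + L * ?t\<^sup>2 * ?\<delta>\<^sup>2 / 2 < M / (1 + \<nu>) * (?t * ?\<delta>) powr (1 + \<nu>)"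
    using i by simp
  then show ?thesis
    using L t gap s_neq[OF y gap] nu M_pos by (intro rejected_L_bound) auto
qed

lemma f_le_f0_max: "f i y \<le> f0_max g h y" if "y \<in> domG g"
proof -
  have "(MAX i. objective g h y i) = Max (ereal ` range (\<lambda>i. f i y))"
    using that by (simp add: objective_eq image_image)
  also have "\<dots> = ereal (MAX i. f i y)"
    by (rule mono_Max_commute[symmetric]) (auto simp: mono_def)
  finally show ?thesis by (simp add: f0_max_def)
qed

text \<open>On the compact domain \<open>g i\<close> is bounded below by lower semicontinuity and
  \<open>h i\<close> is bounded by continuity. This keeps \<open>f_inf\<close> from being the
  default value of an infinite infimum.\<close>

lemma f_bounded_below: "\<exists>c. \<forall>y\<in>domG g. c \<le> f i y"
proof -
  obtain a where a: "\<forall>y\<in>domG g. ereal a \<le> g i y"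
    using lsc_compact_bounded_below[OF g_proper g_lsc domG_compact] by blast
  have "continuous_on (domG g) (h i)"
    using h_grad[of i] by (intro continuous_at_imp_continuous_on)
      (auto simp: gderiv_def intro: has_derivative_continuous)
  then have "bounded (h i ` domG g)"
    using domG_compact by (intro compact_imp_bounded compact_continuous_image)
  then obtain b where b: "\<And>y. y \<in> domG g \<Longrightarrow> \<bar>h i y\<bar> \<le> b"
    by (auto simp: bounded_iff)
  have "a - b \<le> f i y" if y: "y \<in> domG g" for y
  proof -
    have "a \<le> G i y" using a y by (metis ereal_less_eq(3) g_eq_G)
    with b[OF y] show ?thesis by linarith
  qed
  then show ?thesis by blast
qed

lemma f_inf_le: "f_inf g h \<le> f i y" if y: "y \<in> domG g"
proof -
  let ?m = "MIN i. INF y\<in>domG g. objective g h y i"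
  obtain c where c: "\<And>i y. y \<in> domG g \<Longrightarrow> c i \<le> f i y"
    using f_bounded_below by metis
  have "?m \<in> range (\<lambda>i. INF y\<in>domG g. objective g h y i)"
    by (rule Min_in) auto
  then obtain j where j: "?m = (INF y\<in>domG g. objective g h y j)" by blast
  have lower: "ereal (c j) \<le> ?m"
    unfolding j using c by (intro INF_greatest) (simp add: objective_eq)
  have "?m \<le> (INF y\<in>domG g. objective g h y i)"
    by (rule Min_le) auto
  also have "\<dots> \<le> objective g h y i"
    using y by (rule INF_lower)
  finally have "?m \<le> ereal (f i y)"
    unfolding objective_eq[OF y] .
  \<comment> \<open>Since \<open>real_of_ereal\<close> maps infinities to 0, monotonicity needs a
    finite bound on both sides.\<close>
  moreover have "real_of_ereal m \<le> b" if "ereal a \<le> m" "m \<le> ereal b" for m a b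
    using that by (cases m) auto
  ultimately show ?thesis
    unfolding f_inf_def using lower by blast
qed

end


section \<open>A run of the algorithm: control of \<open>L\<close> and the convergence rate\<close>

locale fgm_run = composite_problem g h dh s Mi \<nu> M D
  for g :: "'m::finite \<Rightarrow> real ^ 'n \<Rightarrow> ereal"
    and h dh s Mi \<nu> M D +
  fixes Linit :: real and x :: "nat \<Rightarrow> real ^ 'n" and L t :: "nat \<Rightarrow> real"
  assumes algorithm: "FGM_CondG g h dh s Linit x L t"
begin

abbreviation \<theta> :: "nat \<Rightarrow> real" where
  "\<theta> j \<equiv> \<bar>gap g dh (x j)\<bar>"

abbreviation \<delta> :: "nat \<Rightarrow> real" where
  "\<delta> j \<equiv> norm (s (x j) - x j)"

lemma gap_neq_0: "gap g dh (x j) \<noteq> 0"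
  using algorithm by (simp add: FGM_CondG_def)

lemma backtracking:
  obtains l where "accepted g h dh s (x j) (trial_L Linit L j l)"
    "\<And>l'. l' < l \<Longrightarrow> \<not> accepted g h dh s (x j) (trial_L Linit L j l')"
    "L j = trial_L Linit L j l"
  using algorithm unfolding FGM_CondG_def by blast

lemma x_Suc: "x (Suc j) = trial_point g dh s (x j) (L j)"
  using algorithm unfolding FGM_CondG_def by blast

lemma L_accepted: "accepted g h dh s (x j) (L j)"
  using backtracking by metis

lemma Linit_pos: "0 < Linit"
  using algorithm by (simp add: FGM_CondG_def)

lemma L_pos_if: "0 < prev_L Linit L j \<Longrightarrow> 0 < L j"
  using backtracking[of j] by (metis trial_L_def mult_pos_pos zero_less_power_int zero_less_numeral)

lemma prev_L_pos: "0 < prev_L Linit L j"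
  by (induction j) (use Linit_pos L_pos_if in \<open>auto simp: prev_L_def\<close>)

lemma L_pos: "0 < L j"
  using L_pos_if prev_L_pos by blast

lemma x_in: "x j \<in> domG g"
proof (induction j)
  case 0
  then show ?case using algorithm by (simp add: FGM_CondG_def)
next
  case (Suc j)
  then show ?case using trial_point_in L_pos gap_neq_0 by (simp add: x_Suc)
qed

lemma \<delta>_pos: "0 < \<delta> j"
  using s_neq[OF x_in gap_neq_0] by simp

lemma \<delta>_le: "\<delta> j \<le> D"
  using norm_step_le x_in by blast

lemma D_pos: "0 < D"
  using \<delta>_pos \<delta>_le less_le_trans by blast

text \<open>Trial 0 already carries the factor 1/2, which gives the first alternative. Otherwise the
  trial before the accepted one was rejected, and its constant is half of
  \<open>L j\<close>.\<close>

lemma L_halved_or_bounded: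
  "L j = prev_L Linit L j / 2
    \<or> L j \<le> (M * (2 * \<delta> j / \<theta> j) powr (1 - \<nu>)) powr (1 / \<nu>)"
proof -
  obtain l where rejected: "\<And>l'. l' < l \<Longrightarrow> \<not> accepted g h dh s (x j) (trial_L Linit L j l')"
    and L: "L j = trial_L Linit L j l"
    using backtracking by metis
  show ?thesis
  proof (cases l)
    case 0
    then show ?thesis using L by (simp add: trial_L_def power_int_def)
  next
    case (Suc l')
    have "trial_L Linit L j l = 2 * trial_L Linit L j l'"
      by (simp add: trial_L_def Suc power_int_diff)
    moreover have "0 < trial_L Linit L j l'"
      using prev_L_pos by (simp add: trial_L_def)
    ultimately show ?thesis
      using rejected_bound[OF _ x_in gap_neq_0 rejected, of l'] L Suc by simp
  qed
qed

text \<open>The bound of a rejected trial, made uniform over iterations with gap at least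
  \<open>\<theta>\<^sub>0\<close> by replacing \<open>\<delta> j\<close> with
  \<open>D\<close>.\<close>

definition K :: "real \<Rightarrow> real" where
  "K \<theta>\<^sub>0 = (M * (2 * D / \<theta>\<^sub>0) powr (1 - \<nu>)) powr (1 / \<nu>)"

text \<open>Once \<open>L\<close> is at most \<open>K \<theta>\<^sub>0\<close>, both alternatives of
  the next iteration keep it there; otherwise it has been halved every time. Iteration 0 halves as
  well, hence the exponent \<open>Suc j\<close>.\<close>

lemma L_le_K_or_initial:
  assumes "0 < \<theta>\<^sub>0" "\<And>i. i \<le> j \<Longrightarrow> \<theta>\<^sub>0 \<le> \<theta> i"
  shows "L j \<le> K \<theta>\<^sub>0 \<or> L j = Linit / 2 ^ Suc j"
proof -
  have step: "L j = prev_L Linit L j / 2 \<or> L j \<le> K \<theta>\<^sub>0" if "\<theta>\<^sub>0 \<le> \<theta> j" for j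
  proof -
    have "(M * (2 * \<delta> j / \<theta> j) powr (1 - \<nu>)) powr (1 / \<nu>) \<le> K \<theta>\<^sub>0"
      unfolding K_def using assms(1) that \<delta>_le[of j] M_pos D_pos nu
      by (intro powr_mono2 mult_left_mono frac_le) auto
    then show ?thesis using L_halved_or_bounded[of j] by linarith
  qed
  show ?thesis
    using assms(2)
  proof (induction j)
    case 0
    then show ?case using step[of 0] by (auto simp: prev_L_def)
  next
    case (Suc j)
    have "L (Suc j) = L j / 2 \<or> L (Suc j) \<le> K \<theta>\<^sub>0"
      using step[of "Suc j"] Suc.prems by (simp add: prev_L_def)
    moreover have "L j \<le> K \<theta>\<^sub>0 \<or> L j = Linit / 2 ^ Suc j"
      using Suc by simp
    ultimately show ?case using L_pos[of j] by auto
  qed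
qed

text \<open>The number \<open>k0\<close> of halvings brings \<open>Linit\<close> down to
  \<open>L_tilde\<close>; at iteration \<open>j \<ge> k0\<close> at least one more has taken place,
  which is the factor 2.\<close>

lemma initial_L_small:
  assumes k0: "k0 = nat \<lceil>max (log 2 (Linit / L_tilde g dh s \<nu> M (x 0))) 0\<rceil>"
    and j: "k0 \<le> j"
  shows "2 * (Linit / 2 ^ Suc j) \<le> L_tilde g dh s \<nu> M (x 0)"
proof -
  let ?T = "L_tilde g dh s \<nu> M (x 0)"
  have T: "0 < ?T"
    using L_eps_pos[of M \<nu> "\<theta> 0 / 2"] M_pos nu gap_neq_0[of 0]
    by (simp add: L_tilde_def less_max_iff_disj)
  have "log 2 (Linit / ?T) \<le> real j"
    using j unfolding k0 by linarith
  then have "Linit / ?T \<le> 2 powr real j"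
    using T Linit_pos by (subst (asm) log_le_iff) auto
  then show ?thesis using T by (simp add: powr_realpow field_simps)
qed

lemma L_late:
  assumes k0: "k0 = nat \<lceil>max (log 2 (Linit / L_tilde g dh s \<nu> M (x 0))) 0\<rceil>"
    and j: "k0 \<le> j"
    and \<theta>\<^sub>0: "0 < \<theta>\<^sub>0" "\<And>i. i \<le> j \<Longrightarrow> \<theta>\<^sub>0 \<le> \<theta> i"
  shows "L j \<le> max (K \<theta>\<^sub>0) (\<theta>\<^sub>0 / (2 * D\<^sup>2))"
proof -
  have "L_tilde g dh s \<nu> M (x 0) \<le> max (K \<theta>\<^sub>0) (\<theta>\<^sub>0 / D\<^sup>2)"
    unfolding L_tilde_def K_def using \<theta>\<^sub>0 \<delta>_pos \<delta>_le M_pos nu by (intro L_tilde_bound) auto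
  moreover have "0 \<le> K \<theta>\<^sub>0" by (simp add: K_def)
  moreover have "L j \<le> K \<theta>\<^sub>0 \<or> L j = Linit / 2 ^ Suc j"
    using L_le_K_or_initial \<theta>\<^sub>0 by blast
  moreover have "\<theta>\<^sub>0 / (2 * D\<^sup>2) = (\<theta>\<^sub>0 / D\<^sup>2) / 2" by simp
  ultimately show ?thesis
    using initial_L_small[OF k0 j] by linarith
qed

lemma f_decrease:
  "f i (x (Suc j)) \<le> f i (x j) - min (\<theta> j / 4) ((\<theta> j)\<^sup>2 / (8 * L j * (\<delta> j)\<^sup>2))"
  unfolding x_Suc using accepted_decrease L_pos x_in gap_neq_0 L_accepted by blast

text \<open>Covers the iterations before \<open>k0\<close>, for which no uniform decrease is
  claimed.\<close>

lemma f_antimono: "f i (x (Suc j)) \<le> f i (x j)"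
proof -
  have "0 \<le> min (\<theta> j / 4) ((\<theta> j)\<^sup>2 / (8 * L j * (\<delta> j)\<^sup>2))"
    using L_pos[of j] by simp
  then show ?thesis using f_decrease[of i j] by linarith
qed

lemma f_decrease_late:
  assumes k0: "k0 = nat \<lceil>max (log 2 (Linit / L_tilde g dh s \<nu> M (x 0))) 0\<rceil>"
    and j: "k0 \<le> j"
    and \<theta>\<^sub>0: "0 < \<theta>\<^sub>0" "\<And>i. i \<le> j \<Longrightarrow> \<theta>\<^sub>0 \<le> \<theta> i"
  shows "f i (x (Suc j)) \<le> f i (x j) - min (\<theta>\<^sub>0 / 4) (\<theta>\<^sub>0\<^sup>2 / (8 * K \<theta>\<^sub>0 * D\<^sup>2))"
proof -
  have le: "\<theta>\<^sub>0\<^sup>2 / (8 * L j * D\<^sup>2) \<le> (\<theta> j)\<^sup>2 / (8 * L j * (\<delta> j)\<^sup>2)"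
    using \<theta>\<^sub>0(1) \<theta>\<^sub>0(2)[of j] L_pos[of j] \<delta>_pos[of j] \<delta>_le[of j]
    by (intro frac_le mult_left_mono power_mono) (auto intro!: mult_pos_pos)
  have K: "0 < K \<theta>\<^sub>0" using M_pos D_pos \<theta>\<^sub>0 by (auto simp: K_def)
  have "min (\<theta>\<^sub>0 / 4) (\<theta>\<^sub>0\<^sup>2 / (8 * K \<theta>\<^sub>0 * D\<^sup>2)) \<le> \<theta>\<^sub>0\<^sup>2 / (8 * L j * D\<^sup>2)"
  proof (cases "L j \<le> K \<theta>\<^sub>0")
    case True
    then have "\<theta>\<^sub>0\<^sup>2 / (8 * K \<theta>\<^sub>0 * D\<^sup>2) \<le> \<theta>\<^sub>0\<^sup>2 / (8 * L j * D\<^sup>2)"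
      using L_pos[of j] D_pos by (intro frac_le) auto
    then show ?thesis by linarith
  next
    case False
    \<comment> \<open>The spare factor 2 from \<open>initial_L_small\<close> makes this threshold
      exactly the one at which the quadratic decrease reaches
      \<open>\<theta>\<^sub>0 / 4\<close>.\<close>
    then have "L j \<le> \<theta>\<^sub>0 / (2 * D\<^sup>2)"
      using L_late[OF k0 j \<theta>\<^sub>0] by (auto simp: le_max_iff_disj)
    then have "2 * L j * D\<^sup>2 \<le> \<theta>\<^sub>0" using D_pos by (simp add: field_simps)
    then have "\<theta>\<^sub>0 * (8 * L j * D\<^sup>2) \<le> \<theta>\<^sub>0 * (4 * \<theta>\<^sub>0)"
      using \<theta>\<^sub>0 by (intro mult_left_mono) auto
    then have "\<theta>\<^sub>0 / 4 \<le> \<theta>\<^sub>0\<^sup>2 / (8 * L j * D\<^sup>2)"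
      using L_pos[of j] D_pos by (subst pos_le_divide_eq) (auto simp: power2_eq_square)
    then show ?thesis by linarith
  qed
  with le \<theta>\<^sub>0(2)[of j]
  have "min (\<theta>\<^sub>0 / 4) (\<theta>\<^sub>0\<^sup>2 / (8 * K \<theta>\<^sub>0 * D\<^sup>2)) \<le> min (\<theta> j / 4) ((\<theta> j)\<^sup>2 / (8 * L j * (\<delta> j)\<^sup>2))"
    by auto
  then show ?thesis using f_decrease[of i j] by linarith
qed

lemma convergence_rate:
  assumes k0: "k0 = nat \<lceil>max (log 2 (Linit / L_tilde g dh s \<nu> M (x 0))) 0\<rceil>"
    and k: "k0 \<le> k"
  shows "(MIN j\<in>{0..k}. \<theta> j) \<le>
    max (4 * (f0_max g h (x 0) - f_inf g h) / (real k + 1 - real k0))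
      ((2 powr (2 + 1 / \<nu>) * M powr (1 / \<nu>) * D powr ((1 + \<nu>) / \<nu>)
        * (f0_max g h (x 0) - f_inf g h) / (real k + 1 - real k0)) powr (\<nu> / (1 + \<nu>)))"
proof -
  define \<theta>\<^sub>0 where "\<theta>\<^sub>0 = (MIN j\<in>{0..k}. \<theta> j)"
  define d where "d = min (\<theta>\<^sub>0 / 4) (\<theta>\<^sub>0\<^sup>2 / (8 * K \<theta>\<^sub>0 * D\<^sup>2))"
  define n where "n = real k + 1 - real k0"
  define \<Delta> where "\<Delta> = f0_max g h (x 0) - f_inf g h"
  have n: "0 < n" using k by (simp add: n_def)
  have \<theta>\<^sub>0: "0 < \<theta>\<^sub>0" "\<And>i. i \<le> k \<Longrightarrow> \<theta>\<^sub>0 \<le> \<theta> i"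
    unfolding \<theta>\<^sub>0_def using gap_neq_0 by auto
  \<comment> \<open>A single objective suffices: each one lies between \<open>f_inf\<close> and
    \<open>f0_max\<close> at the points used.\<close>
  fix i :: 'm
  have initial: "f i (x k0) \<le> f i (x 0)"
    by (rule lift_Suc_antimono_le[of "\<lambda>j. f i (x j)"]) (auto intro: f_antimono)
  \<comment> \<open>Telescoping over iterations \<open>k0\<close> to \<open>k\<close>, which are
    \<open>n\<close> in number; \<open>m\<close> may therefore run up to
    \<open>Suc k - k0\<close>.\<close>
  have "f i (x (k0 + m)) \<le> f i (x k0) - real m * d" if "k0 + m \<le> Suc k" for m
    using that
  proof (induction m)
    case (Suc m)
    have "f i (x (Suc (k0 + m))) \<le> f i (x (k0 + m)) - d"
      unfolding d_def using Suc.prems \<theta>\<^sub>0 by (intro f_decrease_late[OF k0]) auto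
    then show ?case using Suc by (simp add: algebra_simps)
  qed simp
  moreover have "k0 + (Suc k - k0) = Suc k" "real (Suc k - k0) = n"
    using k by (auto simp: n_def of_nat_diff)
  ultimately have "f i (x (Suc k)) \<le> f i (x k0) - n * d"
    by (metis order_refl)
  then have "n * d \<le> \<Delta>"
    using initial f_le_f0_max[OF x_in[of 0], of i] f_inf_le[OF x_in[of "Suc k"], of i]
    unfolding \<Delta>_def by linarith
  then have "d \<le> \<Delta> / n" using n by (simp add: field_simps)
  \<comment> \<open>Whichever entry attains the minimum \<open>d\<close> yields the corresponding
    term of the maximum in the claim.\<close>
  then consider "\<theta>\<^sub>0 / 4 \<le> \<Delta> / n" | "\<theta>\<^sub>0\<^sup>2 / (8 * K \<theta>\<^sub>0 * D\<^sup>2) \<le> \<Delta> / n"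
    unfolding d_def by (auto simp: min_le_iff_disj)
  then have "\<theta>\<^sub>0 \<le> max (4 * \<Delta> / n)
      ((2 powr (2 + 1 / \<nu>) * M powr (1 / \<nu>) * D powr ((1 + \<nu>) / \<nu>) * \<Delta> / n) powr (\<nu> / (1 + \<nu>)))"
  proof cases
    case 1
    then show ?thesis by (simp add: le_max_iff_disj mult.commute)
  next
    case 2
    then show ?thesis
      using rate_from_decrease[of \<theta>\<^sub>0 D M \<nu> "\<Delta> / n"] \<theta>\<^sub>0 D_pos M_pos nu
      by (simp add: K_def le_max_iff_disj)
  qed
  then show ?thesis unfolding \<theta>\<^sub>0_def \<Delta>_def n_def .
qed

end

theorem theorem4p6:
  fixes g :: "'m::finite \<Rightarrow> real ^ 'n \<Rightarrow> ereal"
    and h :: "'m \<Rightarrow> real ^ 'n \<Rightarrow> real"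
    and dh :: "'m \<Rightarrow> real ^ 'n \<Rightarrow> real ^ 'n"
    and s :: "real ^ 'n \<Rightarrow> real ^ 'n"
    and Mi :: "'m \<Rightarrow> real"
    and \<nu> M D Linit :: real
    and x :: "nat \<Rightarrow> real ^ 'n"
    and L t :: "nat \<Rightarrow> real"
    and k0 k :: nat
  assumes g_proper: "\<And>i. proper (g i)"
    and g_convex: "\<And>i. convex_fun (g i)"
    and g_lsc: "\<And>i. lsc (g i)"
    and h_grad: "\<And>i y. GDERIV (h i) y :> dh i y"
    and h_C1: "\<And>i. continuous_on UNIV (dh i)"
    and domG_nonempty: "domG g \<noteq> {}"
    and domG_convex: "convex (domG g)"
    and domG_compact: "compact (domG g)"
    and nu: "0 < \<nu>" "\<nu> \<le> 1"
    and Mi_pos: "\<And>i. Mi i > 0"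
    and hoelder: "\<And>i y z. y \<in> edom (g i) \<Longrightarrow> z \<in> edom (g i) \<Longrightarrow>
                    norm (dh i y - dh i z) \<le> Mi i * norm (y - z) powr \<nu>"
    and M_def: "M = (MAX i. Mi i)"
    and D_def: "D = diameter (domG g)"
    and s_minimizer: "\<And>y. y \<in> domG g \<Longrightarrow>
                        s y \<in> domG g \<and> is_arg_min (gap_model g dh y) (\<lambda>u. True) (s y)"
    and algorithm: "FGM_CondG g h dh s Linit x L t"
    and k0_def: "k0 = nat \<lceil>max (log 2 (Linit / L_tilde g dh s \<nu> M (x 0))) 0\<rceil>"
    and k_ge: "k \<ge> k0"
  shows "(MIN j\<in>{0..k}. \<bar>gap g dh (x j)\<bar>) \<le>
           max (4 * (f0_max g h (x 0) - f_inf g h) / (real k + 1 - real k0))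
               ((2 powr (2 + 1 / \<nu>) * M powr (1 / \<nu>) * D powr ((1 + \<nu>) / \<nu>)
                   * (f0_max g h (x 0) - f_inf g h) / (real k + 1 - real k0)) powr (\<nu> / (1 + \<nu>)))"
proof -
  interpret fgm_run g h dh s Mi \<nu> M D Linit x L t
    by unfold_locales (fact g_proper g_convex g_lsc h_grad domG_convex domG_compact nu Mi_pos
      hoelder M_def D_def s_minimizer algorithm)+
  show ?thesis using convergence_rate[OF k0_def k_ge] .
qed

end
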